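(* For all general $a,k,\alpha,\beta\in\mathbb{C}$ (that is, such that the individual terms of the series and the right-hand side below are defined), write $$\alpha_{\pm}=\alpha\pm i\sqrt{1-\alpha^2},\qquad \beta_{\pm}=\beta\pm i\sqrt{1-\beta^2}.$$ Then $$\sum_{n,p\ge 0}\frac{T_n(\alpha)\,T_p(\beta)}{(a\pi)^{n+p}\,(k)_{1-n-p}}=\frac{S}{4i\,k(k+1)\,(a\pi)^{k}\,\sqrt{1-\alpha^2}\,(\alpha-\beta)\,\sqrt{1-\beta^2}},$$ where the sum is over all integers $n,p\ge 0$ and $$\begin{aligned} S={}&\sqrt{1-\beta^2}\,e^{a\pi\alpha_-}\Big[\alpha_-^{-k-2}\,\Gamma(k+2,a\pi\alpha_-)-(k+1)(\alpha+\beta)\,\alpha_-^{-k-1}\,\Gamma(k+1,a\pi\alpha_-)+k(k+1)\alpha\beta\,\alpha_-^{-k}\,\Gamma(k,a\pi\alpha_-)\Big]\\ &-\sqrt{1-\beta^2}\,e^{a\pi\alpha_+}\Big[\alpha_+^{-k-2}\,\Gamma(k+2,a\pi\alpha_+)-(k+1)(\alpha+\beta)\,\alpha_+^{-k-1}\,\Gamma(k+1,a\pi\alpha_+)+k(k+1)\alpha\beta\,\alpha_+^{-k}\,\Gamma(k,a\pi\alpha_+)\Big]\\ &-\sqrt{1-\alpha^2}\,e^{a\pi\beta_-}\Big[\beta_-^{-k-2}\,\Gamma(k+2,a\pi\beta_-)-(k+1)(\alpha+\beta)\,\beta_-^{-k-1}\,\Gamma(k+1,a\pi\beta_-)+k(k+1)\alpha\beta\,\beta_-^{-k}\,\Gamma(k,a\pi\beta_-)\Big]\\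 &+\sqrt{1-\alpha^2}\,e^{a\pi\beta_+}\Big[\beta_+^{-k-2}\,\Gamma(k+2,a\pi\beta_+)-(k+1)(\alpha+\beta)\,\beta_+^{-k-1}\,\Gamma(k+1,a\pi\beta_+)+k(k+1)\alpha\beta\,\beta_+^{-k}\,\Gamma(k,a\pi\beta_+)\Big]. \end{aligned}$$
   Context: $T_n$ is the Chebyshev polynomial of the first kind, $T_n(\cos\theta)=\cos(n\theta)$. $(k)_m=\Gamma(k+m)/\Gamma(k)$ is the Pochhammer symbol, used here for integers $m$ of either sign, so that $1/(k)_{1-n-p}=\Gamma(k)/\Gamma(k+1-n-p)$ (with $1/\Gamma$ regarded as an entire function). $\Gamma(s,z)$ is the upper incomplete gamma function, $\Gamma(s,z)=\int_z^\infty t^{s-1}e^{-t}\,dt$ for $\mathrm{Re}(s)>0$, extended by analytic continuation; for $z\ne 0$ it is an entire function of $s$, and it satisfies $\gamma(s,z)+\Gamma(s,z)=\Gamma(s)$ for $s\neq 0,-1,-2,\dots$, where $\gamma(s,z)=\int_0^z t^{s-1}e^{-t}\,dt$ for $\mathrm{Re}(s)>0$, and $\Gamma(s,ze^{2m\pi i})=e^{2\pi i m s}\Gamma(s,z)+(1-e^{2\pi i m s})\Gamma(s)$ for $m\in\mathbb{Z}$. Complex powers, square roots and $\Gamma(s,z)$ take their principal values.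
   Formalization: The formal theorem additionally assumes that the double series converges; for k not a positive integer its terms grow factorially and it diverges (e.g. k=1/2, a=1, α=0, β=1/2), so the identity is proved exactly for positive integers k, where the sum is finite. *)

theory Defs
  imports "HOL-Analysis.Analysis"
begin

fun cheb_T :: "nat \<Rightarrow> 'a::comm_ring_1 \<Rightarrow> 'a" where
  "cheb_T 0 x = 1"
| "cheb_T (Suc 0) x = x"
| "cheb_T (Suc (Suc n)) x = 2 * x * cheb_T (Suc n) x - cheb_T n x"

lemma cheb_T_cos:
  fixes \<theta> :: complex
  shows "cheb_T n (cos \<theta>) = cos (of_nat n * \<theta>)"
proof (induction n rule: induct_nat_012)
  case (ge2 n)
  have "cos (of_nat (Suc (Suc n)) * \<theta>) + cos (of_nat n * \<theta>)
      = cos (of_nat (Suc n) * \<theta> + \<theta>) + cos (of_nat (Suc n) * \<theta> - \<theta>)"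
    by (simp add: algebra_simps)
  also have "\<dots> = 2 * cos \<theta> * cos (of_nat (Suc n) * \<theta>)"
    by (simp only: cos_add cos_diff) (simp add: algebra_simps)
  finally show ?case
    unfolding cheb_T.simps ge2 by algebra
qed simp_all

text \<open>
  \<open>1 / (k)\<^sub>m\<close> for an integer \<open>m\<close> of either sign, where \<open>(k)\<^sub>m = \<Gamma>(k + m) / \<Gamma>(k)\<close>.  It is written
  with the entire function \<^const>\<open>rGamma\<close> (that is, \<open>1/\<Gamma>\<close>), so that it vanishes when \<open>k + m\<close> is a
  pole of \<open>\<Gamma>\<close>.  It is meaningful for \<open>k \<notin> \<int>\<^sub>\<le>\<^sub>0\<close> only.
\<close>

definition inverse_poch :: "complex \<Rightarrow> int \<Rightarrow> complex" where
  "inverse_poch k m = Gamma k * rGamma (k + of_int m)"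

text \<open>
  The principal value of \<open>\<Gamma>(s, z) = \<integral>\<^sub>z\<^sup>\<infinity> t\<^sup>s\<^sup>-\<^sup>1 e\<^sup>-\<^sup>t dt\<close> for \<open>z \<noteq> 0\<close>.  The path is the ray \<open>z + c x\<close>,
  \<open>x \<ge> 0\<close>.  It is horizontal (\<open>c = 1\<close>) unless \<open>z\<close> lies on the branch cut, where \<open>c = 1 + \<i>\<close>
  leaves the cut into the upper half-plane, in accordance with \<open>arg z = \<pi>\<close>.  The path avoids \<open>0\<close>,
  so the integral converges for every \<open>s\<close> and is entire in \<open>s\<close>; for \<open>Re s \<le> 0\<close> it therefore is the
  analytic continuation in \<open>s\<close> of the values for \<open>Re s > 0\<close>.
\<close>

definition upper_Gamma :: "complex \<Rightarrow> complex \<Rightarrow> complex" where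
  "upper_Gamma s z =
    (let c = (if z \<in> \<real>\<^sub>\<le>\<^sub>0 then 1 + \<i> else 1) in
       integral {0..} (\<lambda>x::real. (z + c * of_real x) powr (s - 1) * exp (- (z + c * of_real x)) * c))"

definition root_plus :: "complex \<Rightarrow> complex" where
  "root_plus x = x + \<i> * csqrt (1 - x\<^sup>2)"

definition root_minus :: "complex \<Rightarrow> complex" where
  "root_minus x = x - \<i> * csqrt (1 - x\<^sup>2)"

text \<open>
  The summand common to the four lines of \<open>S\<close>, as a function of
  \<open>u \<in> {\<alpha>\<^sub>-, \<alpha>\<^sub>+, \<beta>\<^sub>-, \<beta>\<^sub>+}\<close>.
\<close>

definition S_term :: "complex \<Rightarrow> complex \<Rightarrow> complex \<Rightarrow> complex \<Rightarrow> complex \<Rightarrow> complex" where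
  "S_term a k \<alpha> \<beta> u =
     exp (a * of_real pi * u) *
       (u powr (- k - 2) * upper_Gamma (k + 2) (a * of_real pi * u)
        - (k + 1) * (\<alpha> + \<beta>) * u powr (- k - 1) * upper_Gamma (k + 1) (a * of_real pi * u)
        + k * (k + 1) * \<alpha> * \<beta> * u powr (- k) * upper_Gamma k (a * of_real pi * u))"

definition S_sum :: "complex \<Rightarrow> complex \<Rightarrow> complex \<Rightarrow> complex \<Rightarrow> complex" where
  "S_sum a k \<alpha> \<beta> =
       csqrt (1 - \<beta>\<^sup>2) * S_term a k \<alpha> \<beta> (root_minus \<alpha>)
     - csqrt (1 - \<beta>\<^sup>2) * S_term a k \<alpha> \<beta> (root_plus \<alpha>)
     - csqrt (1 - \<alpha>\<^sup>2) * S_term a k \<alpha> \<beta> (root_minus \<beta>)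
     + csqrt (1 - \<alpha>\<^sup>2) * S_term a k \<alpha> \<beta> (root_plus \<beta>)"

definition cheb_summand :: "complex \<Rightarrow> complex \<Rightarrow> complex \<Rightarrow> complex \<Rightarrow> nat \<Rightarrow> nat \<Rightarrow> complex" where
  "cheb_summand a k \<alpha> \<beta> n p =
     cheb_T n \<alpha> * cheb_T p \<beta> / (a * of_real pi) ^ (n + p) * inverse_poch k (1 - int n - int p)"

end

theory Submission
  imports Defs
begin

text \<open>
  Summability forces \<open>k\<close> to be a positive integer: otherwise \<open>1/\<Gamma>(k + 1 - n)\<close> grows factorially,
  while two consecutive values \<open>T\<^sub>n(\<alpha>)\<close>, \<open>T\<^sub>n\<^sub>+\<^sub>1(\<alpha>)\<close> decay at most geometrically.  For a positive integer
  \<open>k\<close> the series is a finite sum over \<open>n + p \<le> k\<close>, and \<open>\<Gamma>(s, z)\<close> for integer \<open>s\<close> is \<open>e\<^sup>-\<^sup>z\<close> times a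
  polynomial.  Since \<open>\<alpha>\<^sub>+ \<alpha>\<^sub>- = 1\<close>, comparing the powers of \<open>a \<pi>\<close> on both sides leaves the closed
  form of the convolution \<open>\<Sum>\<^bsub>n+p=m\<^esub> T\<^sub>n(\<alpha>) T\<^sub>p(\<beta>)\<close>.
\<close>

section \<open>Identities for Chebyshev polynomials\<close>

text \<open>Splitting off the terms n = 0 and n = 1 and applying the recurrence to the factors in x
  shows that the convolution satisfies the Chebyshev recurrence in m up to an inhomogeneous term in
  y. The right-hand side satisfies the same recurrence and has the same two initial values.\<close>

lemma cheb_T_convolution:
  fixes x y :: "'a::comm_ring_1"
  shows "2 * (x - y) * (\<Sum>n\<le>m. cheb_T n x * cheb_T (m - n) y)
    = cheb_T (Suc m) x - y * cheb_T m x - cheb_T (Suc m) y + x * cheb_T m y"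
proof (induction m rule: induct_nat_012)
  case (ge2 m)
  define C where "C l = (\<Sum>n\<le>l. cheb_T n x * cheb_T (l - n) y)" for l
  have C1: "C (Suc m) = cheb_T (Suc m) y + (\<Sum>n\<le>m. cheb_T (Suc n) x * cheb_T (m - n) y)"
    unfolding C_def by (subst sum.atMost_Suc_shift) simp
  have "C (Suc (Suc m)) = cheb_T (Suc (Suc m)) y + x * cheb_T (Suc m) y
      + (\<Sum>n\<le>m. cheb_T (Suc (Suc n)) x * cheb_T (m - n) y)"
    unfolding C_def by (subst sum.atMost_Suc_shift, subst sum.atMost_Suc_shift)
      (simp del: cheb_T.simps(3) add: algebra_simps)
  also have "(\<Sum>n\<le>m. cheb_T (Suc (Suc n)) x * cheb_T (m - n) y)
      = 2 * x * (C (Suc m) - cheb_T (Suc m) y) - C m"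
    unfolding C1 unfolding C_def
    by (simp add: sum_subtractf sum_distrib_left algebra_simps)
  finally have C2: "C (Suc (Suc m))
    = 2 * x * C (Suc m) - C m + cheb_T (Suc (Suc m)) y - x * cheb_T (Suc m) y"
    by (simp add: algebra_simps)
  have "2 * (x - y) * C (Suc (Suc m))
    = 2 * x * (2 * (x - y) * C (Suc m)) - 2 * (x - y) * C m
      + 2 * (x - y) * (cheb_T (Suc (Suc m)) y - x * cheb_T (Suc m) y)"
    unfolding C2 by (simp add: algebra_simps)
  then show ?case
    unfolding ge2[folded C_def] C_def[symmetric] by (simp add: algebra_simps)
qed (simp_all add: algebra_simps)

text \<open>Here v and w are the roots of t^2 - 2xt + 1, so their power sums obey the Chebyshev
  recurrence. It is applied to \<open>root_plus x\<close> and \<open>root_minus x\<close>.\<close>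

lemma cheb_T_power_sum:
  fixes v w x :: complex
  assumes "v + w = 2 * x" and "v * w = 1"
  shows "v ^ n + w ^ n = 2 * cheb_T n x"
proof (induction n rule: induct_nat_012)
  case (ge2 n)
  have "v ^ Suc (Suc n) + w ^ Suc (Suc n)
      = (v + w) * (v ^ Suc n + w ^ Suc n) - (v * w) * (v ^ n + w ^ n)"
    by (simp add: algebra_simps)
  also have "\<dots> = 2 * cheb_T (Suc (Suc n)) x"
    unfolding ge2 assms by (simp add: algebra_simps)
  finally show ?case .
qed (use assms in auto)

section \<open>The incomplete gamma function at positive integers\<close>

text \<open>Half of the exponential decay absorbs the polynomial factor. The bound yields both an
  integrable majorant and the limit at infinity; \<open>Re c = 1\<close> covers both directions of
  the ray in \<open>upper_Gamma\<close>.\<close>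

lemma norm_power_exp_ray_bound:
  fixes z c :: complex
  assumes "Re c = 1"
  obtains M where "\<And>x. x \<ge> 0 \<Longrightarrow>
    norm ((z + c * of_real x) ^ n * exp (- (z + c * of_real x))) \<le> M * exp (- (1/2) * x)"
proof -
  \<comment> \<open>The scale e makes e * norm c = 1/2, so that exp (e * y) costs only exp (x/2) of
    the available decay exp (-x).\<close>
  define e where "e = 1 / (2 * norm c)"
  have c: "norm c > 0"
    using assms by auto
  have e: "e > 0" "e * norm c = 1 / 2"
    using c by (auto simp: e_def)
  define M where "M = fact n / e ^ n * exp (e * norm z) * exp (- Re z)"
  have "norm ((z + c * of_real x) ^ n * exp (- (z + c * of_real x))) \<le> M * exp (- (1/2) * x)"
    if x: "x \<ge> 0" for x
  proof -
    define y where "y = norm z + norm c * x"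
    have y: "y \<ge> 0"
      using x by (simp add: y_def)
    have "norm (z + c * of_real x) \<le> norm z + norm (c * of_real x)"
      by (rule norm_triangle_ineq)
    also have "\<dots> = y"
      using x by (simp add: y_def norm_mult)
    finally have *: "norm (z + c * of_real x) \<le> y" .
    have "(e * y) ^ n / fact n \<le> exp (e * y)"
    proof -
      \<comment> \<open>A single term of the exponential series with nonnegative argument is at most
        the whole sum.\<close>
      have "sum (\<lambda>n. inverse (fact n) * (e * y) ^ n) {n} \<le> (\<Sum>n. inverse (fact n) * (e * y) ^ n)"
        by (rule sum_le_suminf[OF summable_exp]) (use e y in auto)
      also have "\<dots> = exp (e * y)"
        unfolding exp_def by (simp only: real_scaleR_def)
      finally show ?thesis
        by (simp add: divide_inverse mult.commute)
    qed
    then have "y ^ n \<le> fact n / e ^ n * exp (e * y)"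
      using e by (simp add: field_simps)
    also have "e * y = e * norm z + x / 2"
      using e by (simp add: y_def algebra_simps)
    finally have **: "y ^ n \<le> fact n / e ^ n * exp (e * norm z + x / 2)" .
    have "norm ((z + c * of_real x) ^ n * exp (- (z + c * of_real x)))
        = norm (z + c * of_real x) ^ n * exp (- Re z - x)"
      using assms by (simp add: norm_mult norm_power)
    also have "\<dots> \<le> y ^ n * exp (- Re z - x)"
      using * by (intro mult_right_mono power_mono) auto
    also have "\<dots> \<le> fact n / e ^ n * exp (e * norm z + x / 2) * exp (- Re z - x)"
      by (intro mult_right_mono **) auto
    also have "\<dots> = M * exp (- (1/2) * x)"
      by (simp add: M_def flip: exp_add)
    finally show ?thesis .
  qed
  then show thesis by (rule that)
qed

lemma tendsto_power_exp_ray: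
  fixes z c :: complex
  assumes "Re c = 1"
  shows "((\<lambda>x. (z + c * of_real x) ^ n * exp (- (z + c * of_real x))) \<longlongrightarrow> 0) at_top"
proof -
  obtain M where M: "\<And>x. x \<ge> 0 \<Longrightarrow>
    norm ((z + c * of_real x) ^ n * exp (- (z + c * of_real x))) \<le> M * exp (- (1/2) * x)"
    using norm_power_exp_ray_bound[OF assms] by blast
  show ?thesis
  proof (rule Lim_null_comparison)
    have "filterlim (\<lambda>x::real. - (1/2) * x) at_bot at_top"
      by (rule filterlim_tendsto_neg_mult_at_bot[OF tendsto_const _ filterlim_ident]) simp
    from filterlim_compose[OF exp_at_bot this]
    show "((\<lambda>x. M * exp (- (1/2) * x)) \<longlongrightarrow> 0) at_top"
      by (rule tendsto_mult_right_zero)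
  qed (use M in \<open>auto intro: eventually_mono[OF eventually_ge_at_top[of 0]]\<close>)
qed

text \<open>For an integer exponent the integrand has an entire elementary antiderivative G that
  tends to 0 along the ray. The integral is therefore - G z for either choice of the direction
  c.\<close>

lemma upper_Gamma_of_nat_Suc:
  assumes z: "z \<noteq> 0"
  shows "upper_Gamma (of_nat (Suc n)) z = fact n * exp (- z) * (\<Sum>j\<le>n. z ^ j / fact j)"
proof -
  define c where "c = (if z \<in> \<real>\<^sub>\<le>\<^sub>0 then 1 + \<i> else (1::complex))"
  have c: "Re c = 1"
    by (simp add: c_def)
  \<comment> \<open>Needed to replace \<open>powr\<close> by the ordinary power: at base 0 the two
    disagree for exponent 0.\<close>
  have nz: "z + c * of_real x \<noteq> 0" if "x \<ge> 0" for x
  proof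
    assume eq: "z + c * of_real x = 0"
    show False
    proof (cases "z \<in> \<real>\<^sub>\<le>\<^sub>0")
      case True
      then have "Im z = 0"
        by (auto simp: complex_nonpos_Reals_iff)
      moreover have "Im z + x = 0" "Re z + x = 0"
        using eq True by (auto simp: c_def complex_eq_iff)
      ultimately show False
        using z by (simp add: complex_eq_iff)
    next
      case False
      then have "z = - of_real x"
        using eq by (simp add: c_def eq_neg_iff_add_eq_0)
      with that False show False
        by (simp add: complex_nonpos_Reals_iff)
    qed
  qed
  define f where "f x = (z + c * of_real x) ^ n * exp (- (z + c * of_real x)) * c" for x :: real
  define G where "G w = - fact n * exp (- w) * (\<Sum>j\<le>n. w ^ j / fact j)" for w :: complex
  have G_deriv: "(G has_field_derivative w ^ n * exp (- w)) (at w)" for w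
  proof -
    \<comment> \<open>Differentiation lowers the truncated exponential series by its top term, so in
      the derivative of G all but w^n exp(-w) cancels.\<close>
    have "((\<lambda>w. \<Sum>j\<le>n. w ^ j / fact j) has_field_derivative (\<Sum>j<n. w ^ j / fact j)) (at w)"
    proof (induction n)
      case (Suc n)
      have "((\<lambda>w. w ^ Suc n) has_field_derivative of_nat (Suc n) * w ^ n) (at w)"
        by (rule derivative_eq_intros refl)+ simp
      from DERIV_cdivide[OF this, of "fact (Suc n)"]
      have "((\<lambda>w. w ^ Suc n / fact (Suc n)) has_field_derivative w ^ n / fact n) (at w)"
        by (simp del: of_nat_Suc)
      from DERIV_add[OF Suc this] show ?case
        by simp
    qed simp
    then have "(G has_field_derivative
       (- fact n * - exp (- w)) * (\<Sum>j\<le>n. w ^ j / fact j)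
       + (\<Sum>j<n. w ^ j / fact j) * (- fact n * exp (- w))) (at w)"
      unfolding G_def by (intro DERIV_mult) (auto intro!: derivative_eq_intros)
    also have "(- fact n * - exp (- w)) * (\<Sum>j\<le>n. w ^ j / fact j)
       + (\<Sum>j<n. w ^ j / fact j) * (- fact n * exp (- w)) = w ^ n * exp (- w)"
      by (simp add: lessThan_Suc_atMost[symmetric] algebra_simps)
    finally show ?thesis .
  qed
  have f_int: "(f has_integral G (z + c * of_real b) - G z) {0..b}" if "b \<ge> 0" for b
  proof -
    have "((\<lambda>x. G (z + c * of_real x)) has_vector_derivative f x) (at x within {0..b})" for x
    proof -
      have "((\<lambda>x. z + c * of_real x) has_vector_derivative c) (at x within {0..b})"
        by (auto intro!: derivative_eq_intros)
      from field_vector_diff_chain_within[OF this has_field_derivative_at_within[OF G_deriv]]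
      show ?thesis
        by (simp add: f_def o_def mult_ac)
    qed
    from fundamental_theorem_of_calculus[OF that this] show ?thesis
      by simp
  qed
  obtain M where M: "\<And>x. x \<ge> 0 \<Longrightarrow>
    norm ((z + c * of_real x) ^ n * exp (- (z + c * of_real x))) \<le> M * exp (- (1/2) * x)"
    using norm_power_exp_ray_bound[OF c] by blast
  \<comment> \<open>The half-line is exhausted by the intervals from 0 to m, with the exponential
    bound as majorant.\<close>
  have "(f has_integral - G z) {0..}"
  proof (rule has_integral_dominated_convergence)
    show "((\<lambda>x. if x \<in> {0..real m} then f x else 0) has_integral G (z + c * of_real (real m)) - G z) {0..}" for m
      using f_int[of "real m"] by (subst has_integral_restrict) auto
    have "(\<lambda>x. norm c * (M * exp (- (1/2) * x))) integrable_on {0..}"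
      by (intro integrable_on_mult_right integrable_on_exp_minus_to_infinity) simp
    then show "(\<lambda>x. norm c * (M * exp (- (1/2) * x))) integrable_on {0..}" .
    show "\<forall>x\<in>{0..}. norm (if x \<in> {0..real m} then f x else 0) \<le> norm c * (M * exp (- (1/2) * x))" for m
    proof
      fix x :: real assume x: "x \<in> {0..}"
      have "norm (f x) \<le> norm c * (M * exp (- (1/2) * x))"
        using mult_left_mono[OF M[of x], of "norm c"] x by (simp add: f_def norm_mult mult_ac)
      then show "norm (if x \<in> {0..real m} then f x else 0) \<le> norm c * (M * exp (- (1/2) * x))"
        by (smt (verit) norm_ge_zero norm_zero)
    qed
    show "\<forall>x\<in>{0..}. (\<lambda>m. if x \<in> {0..real m} then f x else 0) \<longlonglongrightarrow> f x"
    proof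
      fix x :: real assume x: "x \<in> {0..}"
      have "\<forall>\<^sub>F m in sequentially. x \<le> real m"
        using filterlim_real_sequentially by (auto simp: filterlim_at_top)
      then have "\<forall>\<^sub>F m in sequentially. (if x \<in> {0..real m} then f x else 0) = f x"
        by eventually_elim (use x in auto)
      then show "(\<lambda>m. if x \<in> {0..real m} then f x else 0) \<longlonglongrightarrow> f x"
        by (rule tendsto_eventually)
    qed
    have "((\<lambda>x. \<Sum>j\<le>n. - fact n / fact j
        * ((z + c * of_real x) ^ j * exp (- (z + c * of_real x)))) \<longlongrightarrow> 0) at_top"
      by (intro tendsto_null_sum tendsto_mult_right_zero tendsto_power_exp_ray c)
    then have "((\<lambda>x. G (z + c * of_real x)) \<longlongrightarrow> 0) at_top"
      by (simp add: G_def sum_distrib_left mult_ac)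
    then have "((\<lambda>x. G (z + c * of_real x) - G z) \<longlongrightarrow> 0 - G z) at_top"
      by (intro tendsto_diff tendsto_const)
    from filterlim_compose[OF this filterlim_real_sequentially]
    show "(\<lambda>m. G (z + c * of_real (real m)) - G z) \<longlonglongrightarrow> - G z"
      by simp
  qed
  then have "integral {0..} f = - G z"
    by (rule integral_unique)
  moreover have "upper_Gamma (of_nat (Suc n)) z = integral {0..} f"
    unfolding upper_Gamma_def Let_def c_def[symmetric]
  proof (rule integral_cong)
    fix x :: real assume "x \<in> {0..}"
    then show "(z + c * of_real x) powr (of_nat (Suc n) - 1) * exp (- (z + c * of_real x)) * c = f x"
      using nz[of x] by (simp add: f_def powr_nat' del: minus_add_distrib)
  qed
  ultimately show ?thesis
    by (simp add: G_def)
qed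

section \<open>Evaluation of S for a positive integer k\<close>

lemma powr_minus_of_nat:
  fixes u :: complex
  assumes "u \<noteq> 0"
  shows "u powr (- of_nat n) = inverse u ^ n"
  using assms by (simp add: powr_minus powr_nat' power_inverse)

text \<open>The exponentials cancel, and each gamma term becomes a factorial times v * E l, with E l
  a truncated exponential sum homogeneous in A and v. The recursion for E expresses the three
  neighbouring sums through E K, and the quadratic (v - \<alpha>)(v - \<beta>) factors out. Writing
  K as \<open>Suc j\<close> makes the lowest index K - 1 a natural number.\<close>

lemma S_term_of_nat:
  fixes a \<alpha> \<beta> u :: complex and j :: nat
  assumes "a \<noteq> 0" and "u \<noteq> 0"
  defines "A \<equiv> a * of_real pi" and "K \<equiv> Suc j" and "v \<equiv> inverse u"
  shows "S_term a (of_nat K) \<alpha> \<beta> u = fact (Suc K) *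
    ((\<Sum>m\<le>K. A ^ m / fact m * v ^ (K - m)) * (v - \<alpha>) * (v - \<beta>)
      - \<alpha> * \<beta> * A ^ K / fact K + A ^ Suc K / fact (Suc K) * v)"
proof -
  have A: "A * u \<noteq> 0"
    using assms by simp
  define E where "E l = (\<Sum>m\<le>l. A ^ m / fact m * v ^ (l - m))" for l
  have uv: "u * v = 1"
    using assms by simp
  have E_Suc: "E (Suc l) = v * E l + A ^ Suc l / fact (Suc l)" for l
    unfolding E_def by (simp add: sum_distrib_left Suc_diff_le mult_ac del: fact_Suc power_Suc)
      (simp add: mult_ac)
  have G: "exp (A * u) * (u powr (- of_nat (Suc l)) * upper_Gamma (of_nat (Suc l)) (A * u))
      = fact l * (v * E l)" for l
  proof -
    have "v ^ l * (A * u) ^ m = A ^ m * v ^ (l - m)" if "m \<le> l" for m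
    proof -
      have "v ^ l = v ^ (l - m) * v ^ m"
        using that by (simp flip: power_add)
      then have "v ^ l * (A * u) ^ m = A ^ m * v ^ (l - m) * (u * v) ^ m"
        by (simp add: power_mult_distrib)
      then show ?thesis by (simp add: uv)
    qed
    then have "E l = (\<Sum>m\<le>l. v ^ l * (A * u) ^ m / fact m)"
      unfolding E_def by (intro sum.cong) auto
    then have E: "v ^ l * (\<Sum>m\<le>l. (A * u) ^ m / fact m) = E l"
      by (simp add: sum_distrib_left)
    have "exp (A * u) * (u powr (- of_nat (Suc l)) * upper_Gamma (of_nat (Suc l)) (A * u))
      = (exp (A * u) * exp (- (A * u))) * (fact l * v * (v ^ l * (\<Sum>m\<le>l. (A * u) ^ m / fact m)))"
      unfolding upper_Gamma_of_nat_Suc[OF A] powr_minus_of_nat[OF assms(2)]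
      by (simp add: v_def mult_ac)
    then show ?thesis
      unfolding E by (simp flip: exp_add)
  qed
  have "S_term a (of_nat K) \<alpha> \<beta> u
    = exp (A * u) * (u powr (- of_nat (Suc (Suc K))) * upper_Gamma (of_nat (Suc (Suc K))) (A * u))
      - (of_nat K + 1) * (\<alpha> + \<beta>) *
          (exp (A * u) * (u powr (- of_nat (Suc K)) * upper_Gamma (of_nat (Suc K)) (A * u)))
      + of_nat K * (of_nat K + 1) * \<alpha> * \<beta> *
          (exp (A * u) * (u powr (- of_nat K) * upper_Gamma (of_nat K) (A * u)))"
  proof -
    have *: "- (of_nat K + 2) = - of_nat K - (2::complex)"
        "- (of_nat K + 1) = - of_nat K - (1::complex)"
        "of_nat (Suc (Suc K)) = of_nat K + (2::complex)" "of_nat (Suc K) = of_nat K + (1::complex)"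
      by simp_all
    show ?thesis
      unfolding S_term_def A_def * by (simp only: algebra_simps mult_1_left mult_1_right)
  qed
  also have "\<dots> = fact (Suc K) * (v * E (Suc K))
      - (of_nat K + 1) * (\<alpha> + \<beta>) * (fact K * (v * E K))
      + of_nat K * (of_nat K + 1) * \<alpha> * \<beta> * (fact j * (v * E j))"
    unfolding G using G[of j] by (simp only: K_def)
  also have "\<dots> = fact (Suc K) * (v * E (Suc K) - (\<alpha> + \<beta>) * (v * E K) + \<alpha> * \<beta> * (v * E j))"
    by (simp add: K_def algebra_simps)
  also have "v * E j = E K - A ^ K / fact K"
    using E_Suc[of j] by (simp only: K_def) simp
  also have "E (Suc K) = v * E K + A ^ Suc K / fact (Suc K)"
    by (rule E_Suc)
  also have "v * (v * E K + A ^ Suc K / fact (Suc K)) - (\<alpha> + \<beta>) * (v * E K)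
       + \<alpha> * \<beta> * (E K - A ^ K / fact K)
     = E K * (v - \<alpha>) * (v - \<beta>) - \<alpha> * \<beta> * A ^ K / fact K + A ^ Suc K / fact (Suc K) * v"
    by (simp only: algebra_simps times_divide_eq_right times_divide_eq_left)
  finally show ?thesis
    unfolding E_def .
qed

text \<open>The two roots are mutually inverse and lie symmetrically about x, so the difference has
  the factor \<i> * s and what remains is symmetric in them, hence expressible by Chebyshev
  polynomials. The alternative for x and y serves the \<alpha> lines and the \<beta> lines of S
  alike.\<close>

lemma S_term_difference:
  fixes a \<alpha> \<beta> x :: complex and j :: nat
  assumes "a \<noteq> 0"
    and x: "x = \<alpha> \<and> y = \<beta> \<or> x = \<beta> \<and> y = \<alpha>"
  defines "A \<equiv> a * of_real pi" and "K \<equiv> Suc j" and "s \<equiv> csqrt (1 - x\<^sup>2)"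
  shows "S_term a (of_nat K) \<alpha> \<beta> (root_minus x) - S_term a (of_nat K) \<alpha> \<beta> (root_plus x)
    = 2 * \<i> * s * fact (Suc K) *
      ((\<Sum>m\<le>K. A ^ m / fact m * (cheb_T (Suc (K - m)) x - y * cheb_T (K - m) x))
        + A ^ Suc K / fact (Suc K))"
proof -
  define v w where "v = root_plus x" and "w = root_minus x"
  have s2: "s\<^sup>2 = 1 - x\<^sup>2"
    by (simp add: s_def)
  have vx: "v - x = \<i> * s" and wx: "w - x = - \<i> * s"
    by (simp_all add: v_def w_def s_def root_plus_def root_minus_def)
  have sum: "v + w = 2 * x"
    using vx wx by algebra
  have "v * w = x\<^sup>2 + s\<^sup>2"
    by (simp add: v_def w_def s_def root_plus_def root_minus_def algebra_simps power2_eq_square)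
  then have vw: "v * w = 1"
    using s2 by simp
  have nz: "v \<noteq> 0" "w \<noteq> 0" and inv: "inverse v = w" "inverse w = v"
    using vw by (auto simp: inverse_unique mult.commute)
  note P = cheb_T_power_sum[OF sum vw]
  define E where "E u = (\<Sum>m\<le>K. A ^ m / fact m * u ^ (K - m))" for u
  have "E v * (v - y) + E w * (w - y) =
    (\<Sum>m\<le>K. A ^ m / fact m * ((v ^ Suc (K - m) + w ^ Suc (K - m)) - y * (v ^ (K - m) + w ^ (K - m))))"
    unfolding E_def sum_distrib_right sum.distrib[symmetric]
    by (intro sum.cong refl) (simp add: algebra_simps add_divide_distrib diff_divide_distrib)
  also have "\<dots> = 2 * (\<Sum>m\<le>K. A ^ m / fact m * (cheb_T (Suc (K - m)) x - y * cheb_T (K - m) x))"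
    unfolding P sum_distrib_left by (intro sum.cong refl) (simp add: algebra_simps)
  finally have E: "E v * (v - y) + E w * (w - y) = \<dots>" .
  have *: "(u - \<alpha>) * (u - \<beta>) = (u - x) * (u - y)" for u
    using x by (auto simp: mult.commute)
  note S = S_term_of_nat[OF assms(1), of _ j \<alpha> \<beta>, folded K_def A_def E_def]
  \<comment> \<open>Inversion exchanges the roots: the term at w is a polynomial in v, and the term
    at v one in w.\<close>
  have Sw: "S_term a (of_nat K) \<alpha> \<beta> w = fact (Suc K) *
      (E v * (v - \<alpha>) * (v - \<beta>) - \<alpha> * \<beta> * A ^ K / fact K + A ^ Suc K / fact (Suc K) * v)"
    using S[OF nz(2)] by (simp only: inv E_def)
  have Sv: "S_term a (of_nat K) \<alpha> \<beta> v = fact (Suc K) *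
      (E w * (w - \<alpha>) * (w - \<beta>) - \<alpha> * \<beta> * A ^ K / fact K + A ^ Suc K / fact (Suc K) * w)"
    using S[OF nz(1)] by (simp only: inv E_def)
  have "S_term a (of_nat K) \<alpha> \<beta> w - S_term a (of_nat K) \<alpha> \<beta> v
    = fact (Suc K) * (E v * ((v - \<alpha>) * (v - \<beta>)) - E w * ((w - \<alpha>) * (w - \<beta>))
        + A ^ Suc K / fact (Suc K) * ((v - x) - (w - x)))"
    unfolding Sw Sv by (simp only: algebra_simps)
  \<comment> \<open>The factors v - x and w - x are \<i> * s and - \<i> * s, which turns the
    difference of the E terms into a sum.\<close>
  also have "\<dots> = \<i> * s * fact (Suc K) *
      (E v * (v - y) + E w * (w - y) + 2 * (A ^ Suc K / fact (Suc K)))"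
    unfolding * vx wx by (simp add: algebra_simps del: fact_Suc power_Suc)
  also have "\<dots> = 2 * \<i> * s * fact (Suc K) *
      ((\<Sum>m\<le>K. A ^ m / fact m * (cheb_T (Suc (K - m)) x - y * cheb_T (K - m) x))
        + A ^ Suc K / fact (Suc K))"
    unfolding E by (simp only: algebra_simps mult_2)
  finally show ?thesis
    unfolding v_def w_def .
qed

text \<open>The four lines of S pair up into two differences of \<open>S_term\<close>. Subtracting
  their Chebyshev sums produces, for each m, the right-hand side of
  \<open>cheb_T_convolution\<close>, while the isolated top powers of A cancel.\<close>

lemma S_sum_of_nat:
  fixes a \<alpha> \<beta> :: complex and j :: nat
  assumes "a \<noteq> 0"
  defines "A \<equiv> a * of_real pi" and "K \<equiv> Suc j"
  shows "S_sum a (of_nat K) \<alpha> \<beta> = 4 * \<i> * csqrt (1 - \<alpha>\<^sup>2) * csqrt (1 - \<beta>\<^sup>2) * (\<alpha> - \<beta>) * fact (Suc K) *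
      (\<Sum>m\<le>K. A ^ m / fact m * (\<Sum>n\<le>K - m. cheb_T n \<alpha> * cheb_T (K - m - n) \<beta>))"
proof -
  define F where "F x y = (\<Sum>m\<le>K. A ^ m / fact m * (cheb_T (Suc (K - m)) x - y * cheb_T (K - m) x))"
    for x y :: complex
  define C where "C m = (\<Sum>n\<le>m. cheb_T n \<alpha> * cheb_T (m - n) \<beta>)" for m
  note D = S_term_difference[OF assms(1), where j = j, folded A_def K_def]
  note D\<alpha> = D[of \<alpha> \<alpha> \<beta> \<beta>, OF disjI1[OF conjI[OF refl refl]], folded F_def]
  note D\<beta> = D[of \<beta> \<alpha> \<alpha> \<beta>, OF disjI2[OF conjI[OF refl refl]], folded F_def]
  have "F \<alpha> \<beta> - F \<beta> \<alpha> = (\<Sum>m\<le>K. A ^ m / fact m *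
      (cheb_T (Suc (K - m)) \<alpha> - \<beta> * cheb_T (K - m) \<alpha> - cheb_T (Suc (K - m)) \<beta> + \<alpha> * cheb_T (K - m) \<beta>))"
    unfolding F_def sum_subtractf[symmetric]
    by (intro sum.cong refl) (simp add: algebra_simps add_divide_distrib diff_divide_distrib)
  also have "\<dots> = 2 * (\<alpha> - \<beta>) *
      (\<Sum>m\<le>K. A ^ m / fact m * C (K - m))"
    unfolding cheb_T_convolution[symmetric] C_def[symmetric] sum_distrib_left
    by (intro sum.cong refl) (simp only: mult_ac)
  finally have F: "F \<alpha> \<beta> - F \<beta> \<alpha> = \<dots>" .
  have "S_sum a (of_nat K) \<alpha> \<beta>
    = csqrt (1 - \<beta>\<^sup>2) * (S_term a (of_nat K) \<alpha> \<beta> (root_minus \<alpha>) - S_term a (of_nat K) \<alpha> \<beta> (root_plus \<alpha>))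
    - csqrt (1 - \<alpha>\<^sup>2) * (S_term a (of_nat K) \<alpha> \<beta> (root_minus \<beta>) - S_term a (of_nat K) \<alpha> \<beta> (root_plus \<beta>))"
    unfolding S_sum_def by (simp only: algebra_simps)
  also have "\<dots> = 2 * \<i> * csqrt (1 - \<alpha>\<^sup>2) * csqrt (1 - \<beta>\<^sup>2) * fact (Suc K) * (F \<alpha> \<beta> - F \<beta> \<alpha>)"
    unfolding D\<alpha> D\<beta> by (simp only: algebra_simps)
  finally show ?thesis
    unfolding F C_def[symmetric] by (simp add: mult_ac)
qed

section \<open>Summability forces k to be an integer\<close>

text \<open>Each use of the step inequality halves a bound valid on the whole tail; iterating from
  the global bound B drives it to 0.\<close>

lemma bounded_contracting_imp_0:
  fixes f :: "nat \<Rightarrow> 'a::real_normed_vector"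
  assumes "\<And>n. norm (f n) \<le> B"
    and step: "\<And>n. n \<ge> N \<Longrightarrow> norm (f n) \<le> (norm (f (Suc n)) + norm (f (Suc (Suc n)))) / 4"
    and "n \<ge> N"
  shows "f n = 0"
proof -
  have bound: "norm (f n) \<le> B * (1/2) ^ j" if "n \<ge> N" for n j
    using that
  proof (induction j arbitrary: n)
    case (Suc j)
    show ?case
      using step[of n] Suc.IH[of "Suc n"] Suc.IH[of "Suc (Suc n)"] Suc.prems by simp
  qed (use assms(1) in simp)
  have "(\<lambda>j. B * (1/2) ^ j) \<longlonglongrightarrow> 0"
    by (intro tendsto_mult_right_zero LIMSEQ_realpow_zero) auto
  then have "norm (f n) \<le> 0"
    by (rule tendsto_lowerbound) (use bound[OF assms(3)] in auto)
  then show ?thesis by simp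
qed

text \<open>The recurrence can be run backwards, so vanishing would descend to the value 1 at index
  0.\<close>

lemma cheb_T_not_eventually_0:
  fixes x :: "'a::comm_ring_1"
  assumes "\<And>n. n \<ge> N \<Longrightarrow> cheb_T n x = 0"
  shows False
  using assms
proof (induction N)
  case 0
  then show ?case
    using cheb_T.simps(1)[of x] by simp
next
  case (Suc N)
  have "cheb_T N x = 2 * x * cheb_T (Suc N) x - cheb_T (Suc (Suc N)) x"
    by simp
  also have "\<dots> = 0"
    using Suc.prems by (simp del: cheb_T.simps)
  finally show ?case
    using Suc by (metis le_antisym not_less_eq_eq)
qed

lemma cheb_summand_summable_imp_Ints:
  fixes a k \<alpha> \<beta> :: complex
  assumes a: "a \<noteq> 0" and k: "k \<notin> \<int>\<^sub>\<le>\<^sub>0"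
    and summable: "(\<lambda>(n, p). cheb_summand a k \<alpha> \<beta> n p) summable_on UNIV"
  shows "k \<in> \<int>"
proof (rule ccontr)
  assume nint: "k \<notin> \<int>"
  define A where "A = a * of_real pi"
  have A: "A \<noteq> 0"
    using a by (simp add: A_def)
  define r where "r n = rGamma (k + 1 - of_nat n)" for n
  have nz: "k - of_nat n \<noteq> 0" for n
    using nint by auto
  have r_Suc: "r (Suc n) = (k - of_nat n) * r n" for n
    using rGamma_plus1[of "k - of_nat n"] by (simp add: r_def algebra_simps)
  define f where "f n = cheb_summand a k \<alpha> \<beta> n 0" for n
  have f_eq: "f n = cheb_T n \<alpha> / A ^ n * Gamma k * r n" for n
    by (simp add: f_def cheb_summand_def inverse_poch_def A_def r_def algebra_simps)
  \<comment> \<open>The slice p = 0 already gives the contradiction.\<close>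
  have "(\<lambda>(n, p). cheb_summand a k \<alpha> \<beta> n p) summable_on (\<lambda>n. (n, 0)) ` UNIV"
    using summable by (rule summable_on_subset_banach) simp
  then have "f summable_on UNIV"
    by (subst (asm) summable_on_reindex) (auto simp: inj_on_def o_def f_def[abs_def])
  then have "f \<longlonglongrightarrow> 0"
    by (intro summable_LIMSEQ_zero summable_on_imp_summable)
  then have "Bseq f"
    by (intro convergent_imp_Bseq convergentI)
  then obtain B where B: "\<And>n. norm (f n) \<le> B"
    by (auto simp: Bseq_def)
  \<comment> \<open>The Chebyshev recurrence solved for its lowest index. The factorial growth of r
    puts k - n into the denominators, so both coefficients tend to 0.\<close>
  have rec: "f n = 2 * \<alpha> * A / (k - of_nat n) * f (Suc n)
      - A\<^sup>2 / ((k - of_nat n) * (k - of_nat (Suc n))) * f (Suc (Suc n))" for n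
  proof -
    have "f n = (2 * \<alpha> * cheb_T (Suc n) \<alpha> - cheb_T (Suc (Suc n)) \<alpha>) / A ^ n * Gamma k * r n"
      by (simp add: f_eq)
    also have "\<dots> = 2 * \<alpha> * A / (k - of_nat n) * f (Suc n)
      - A\<^sup>2 / ((k - of_nat n) * (k - of_nat (Suc n))) * f (Suc (Suc n))"
      unfolding f_eq r_Suc using nz[of n] nz[of "Suc n"] A
      by (simp add: divide_simps del: cheb_T.simps of_nat_Suc)
         (simp add: algebra_simps power2_eq_square del: cheb_T.simps of_nat_Suc)
    finally show ?thesis .
  qed
  have lim: "(\<lambda>n. c / (k - of_nat n)) \<longlonglongrightarrow> 0" for c
  proof -
    have "(\<lambda>n. (- c) / (- k + of_nat n)) \<longlonglongrightarrow> 0"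
      by (intro tendsto_divide_0[OF tendsto_const]
          tendsto_add_filterlim_at_infinity[OF tendsto_const] tendsto_of_nat)
    moreover have "(- c) / (- k + of_nat n) = c / (k - of_nat n)" for n
      using minus_divide_divide[of c "k - of_nat n"] by (simp only: minus_diff_eq) simp
    ultimately show ?thesis
      by simp
  qed
  have lim2: "(\<lambda>n. A\<^sup>2 / ((k - of_nat n) * (k - of_nat (Suc n)))) \<longlonglongrightarrow> 0"
    using tendsto_mult[OF lim[of "A\<^sup>2"] LIMSEQ_Suc[OF lim[of 1]]] by simp
  have "\<forall>\<^sub>F n in sequentially. norm (2 * \<alpha> * A / (k - of_nat n)) < 1 / 4
      \<and> norm (A\<^sup>2 / ((k - of_nat n) * (k - of_nat (Suc n)))) < 1 / 4"
    using tendstoD[OF lim[of "2 * \<alpha> * A"], of "1/4"] tendstoD[OF lim2, of "1/4"]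
    by (intro eventually_conj) (simp_all only: dist_norm diff_zero)
  then obtain N where N: "\<And>n. n \<ge> N \<Longrightarrow> norm (2 * \<alpha> * A / (k - of_nat n)) < 1 / 4"
      "\<And>n. n \<ge> N \<Longrightarrow> norm (A\<^sup>2 / ((k - of_nat n) * (k - of_nat (Suc n)))) < 1 / 4"
    by (auto simp: eventually_sequentially)
  have step: "norm (f n) \<le> (norm (f (Suc n)) + norm (f (Suc (Suc n)))) / 4" if "n \<ge> N" for n
  proof -
    have "norm (f n) \<le> norm (2 * \<alpha> * A / (k - of_nat n)) * norm (f (Suc n))
      + norm (A\<^sup>2 / ((k - of_nat n) * (k - of_nat (Suc n)))) * norm (f (Suc (Suc n)))"
      by (subst rec) (metis norm_mult norm_triangle_ineq4)
    also have "\<dots> \<le> 1 / 4 * norm (f (Suc n)) + 1 / 4 * norm (f (Suc (Suc n)))"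
      using N[OF that] by (intro add_mono mult_right_mono) auto
    finally show ?thesis by simp
  qed
  have f0: "f n = 0" if "n \<ge> N" for n
    using B step that by (rule bounded_contracting_imp_0)
  have "cheb_T n \<alpha> = 0" if "n \<ge> N" for n
  proof -
    \<comment> \<open>The zeros of \<open>rGamma\<close> are integers, so r n is nonzero and the
      vanishing of f n passes to the Chebyshev factor.\<close>
    have "k + 1 - of_nat n \<notin> \<int>"
      using nint by (metis Ints_1 Ints_add Ints_diff Ints_of_nat add_diff_cancel diff_add_cancel)
    then have "r n \<noteq> 0"
      unfolding r_def rGamma_eq_zero_iff by auto
    moreover have "Gamma k \<noteq> 0"
      using k by (simp add: Gamma_eq_zero_iff)
    ultimately show ?thesis
      using f0[OF that] A by (simp add: f_eq)
  qed
  then show False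
    by (rule cheb_T_not_eventually_0)
qed

section \<open>The finite double sum and the conclusion\<close>

text \<open>The argument of \<open>rGamma\<close> is Suc j - (n + p) + 1: a positive integer up to
  and including n + p = Suc j, and a zero of \<open>rGamma\<close> beyond. This truncates the
  series.\<close>

lemma inverse_poch_of_nat:
  "inverse_poch (of_nat (Suc j)) (1 - int n - int p)
    = (if n + p \<le> Suc j then fact j / fact (Suc j - (n + p)) else 0)"
proof (cases "n + p \<le> Suc j")
  case True
  then obtain d where d: "Suc j = n + p + d"
    using le_Suc_ex by blast
  have "of_nat (Suc j) + of_int (1 - int n - int p) = (1 + of_nat d :: complex)"
    unfolding d by simp
  moreover have "Gamma (of_nat (Suc j)) = (fact j :: complex)"
    using Gamma_fact[of j, where 'a = complex] by simp
  ultimately show ?thesis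
    using True d Gamma_fact[of d, where 'a = complex]
    by (simp only: inverse_poch_def rGamma_inverse_Gamma) (simp add: divide_inverse)
next
  case False
  then obtain d where d: "n + p = Suc (Suc j) + d"
    by (metis le_Suc_ex not_less_eq_eq)
  have "of_nat (Suc j) + of_int (1 - int n - int p) = (1 + of_nat (Suc j) - of_nat (n + p) :: complex)"
    by simp
  also have "\<dots> = - of_nat d"
    unfolding d by simp
  finally show ?thesis
    using False by (simp add: inverse_poch_def)
qed

text \<open>The inequalities keep the denominators nonzero. The summability hypothesis makes the
  double series meaningful, since \<open>infsum\<close> is 0 by default on a family that is not
  summable.\<close>

theorem theorem5p1:
  fixes a k \<alpha> \<beta> :: complex
  assumes "a \<noteq> 0"
    and "k \<notin> \<int>\<^sub>\<le>\<^sub>0"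
    and "\<alpha>\<^sup>2 \<noteq> 1" and "\<beta>\<^sup>2 \<noteq> 1" and "\<alpha> \<noteq> \<beta>"
    and "(\<lambda>(n, p). cheb_summand a k \<alpha> \<beta> n p) summable_on UNIV"
  shows "(\<Sum>\<^sub>\<infinity>(n, p)\<in>UNIV. cheb_summand a k \<alpha> \<beta> n p)
         = S_sum a k \<alpha> \<beta> /
           (4 * \<i> * k * (k + 1) * (a * of_real pi) powr k
             * csqrt (1 - \<alpha>\<^sup>2) * (\<alpha> - \<beta>) * csqrt (1 - \<beta>\<^sup>2))"
proof -
  have "k \<in> \<int>"
    using cheb_summand_summable_imp_Ints assms by blast
  then obtain i where i: "k = of_int i"
    by (auto elim: Ints_cases)
  with assms(2) have "i > 0"
    by (meson nonpos_Ints_of_int not_le)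
  then obtain j where "i = int (Suc j)"
    using zero_less_imp_eq_int by (metis gr0_implies_Suc)
  with i have k: "k = of_nat (Suc j)"
    by simp
  define K where "K = Suc j"
  define A where "A = a * of_real pi"
  have A: "A \<noteq> 0"
    using assms(1) by (simp add: A_def)
  define C where "C m = (\<Sum>n\<le>m. cheb_T n \<alpha> * cheb_T (m - n) \<beta>)" for m
  let ?f = "\<lambda>(n, p). cheb_summand a k \<alpha> \<beta> n p"
  have fin: "finite {(n, p). n + p \<le> K}"
    by (rule finite_subset[of _ "{..K} \<times> {..K}"]) auto
  have "infsum ?f UNIV = infsum ?f {(n, p). n + p \<le> K}"
    by (rule infsum_cong_neutral)
      (auto simp: cheb_summand_def k inverse_poch_of_nat K_def simp del: of_nat_Suc)
  also have "\<dots> = sum ?f {(n, p). n + p \<le> K}"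
    using fin by simp
  \<comment> \<open>Grouping by m = n + p isolates the Chebyshev convolution, as the remaining
    factors depend on m only.\<close>
  also have "\<dots> = (\<Sum>m\<le>K. \<Sum>n\<le>m. cheb_summand a k \<alpha> \<beta> n (m - n))"
    by (rule sum.triangle_reindex_eq)
  also have "\<dots> = (\<Sum>m\<le>K. fact j / (A ^ m * fact (K - m)) * C m)"
    unfolding C_def sum_distrib_left
  proof (intro sum.cong refl)
    fix m n assume mn: "m \<in> {..K}" "n \<in> {..m}"
    then have "inverse_poch k (1 - int n - int (m - n)) = fact j / fact (K - m)"
      unfolding k inverse_poch_of_nat by (simp add: K_def)
    moreover have "n + (m - n) = m"
      using mn by simp
    ultimately show "cheb_summand a k \<alpha> \<beta> n (m - n)
      = fact j / (A ^ m * fact (K - m)) * (cheb_T n \<alpha> * cheb_T (m - n) \<beta>)"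
      by (simp only: cheb_summand_def A_def) simp
  qed
  \<comment> \<open>Reversal of m matches the ascending powers of A in S; the common factor A^K then
    accounts for \<open>A powr k\<close>.\<close>
  also have "\<dots> = (\<Sum>m\<le>K. fact j / (A ^ (K - m) * fact m) * C (K - m))"
    by (subst sum.nat_diff_reindex[symmetric, of _ "Suc K", unfolded lessThan_Suc_atMost])
      (auto intro!: sum.cong)
  also have "\<dots> = (\<Sum>m\<le>K. fact j / A ^ K * (A ^ m / fact m * C (K - m)))"
    using A by (intro sum.cong refl) (simp add: power_diff)
  also have "\<dots> = fact j / A ^ K * (\<Sum>m\<le>K. A ^ m / fact m * C (K - m))"
    by (simp add: sum_distrib_left)
  finally have lhs: "infsum ?f UNIV = \<dots>" .
  have rhs: "S_sum a k \<alpha> \<beta> = 4 * \<i> * csqrt (1 - \<alpha>\<^sup>2) * csqrt (1 - \<beta>\<^sup>2) * (\<alpha> - \<beta>) * fact (Suc K) *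
      (\<Sum>m\<le>K. A ^ m / fact m * C (K - m))"
    using S_sum_of_nat[OF assms(1), of j \<alpha> \<beta>] by (simp only: k K_def A_def C_def)
  have "fact (Suc K) = k * (k + 1) * fact j"
    by (simp add: K_def k algebra_simps)
  moreover have "A powr k = A ^ K"
    using A powr_nat'[of A K] by (simp only: k K_def) blast
  moreover have "csqrt (1 - \<alpha>\<^sup>2) \<noteq> 0" "csqrt (1 - \<beta>\<^sup>2) \<noteq> 0" "\<alpha> - \<beta> \<noteq> 0"
    using assms by auto
  moreover have "k \<noteq> 0" "k + 1 \<noteq> 0"
    unfolding k by (metis of_nat_eq_0_iff of_nat_Suc add.commute nat.distinct(1))+
  ultimately show ?thesis
    unfolding lhs rhs A_def[symmetric] using A by (simp add: divide_simps)
qed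

end
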